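(* Let $k\geq 2$ be an integer. For the splittable item packing problem with cardinality constraint $k$, the algorithm NEXT FIT has absolute approximation ratio exactly $2-1/k$. That is, for every input $I$, $\mathrm{NF}(I)\leq (2-1/k)\,\mathrm{OPT}(I)$, and for every $\varepsilon>0$ there is an input $I$ with $\mathrm{NF}(I) > (2-1/k-\varepsilon)\,\mathrm{OPT}(I)$.
   Context: Splittable item packing with cardinality constraint $k$: the input is a finite list of items with positive real sizes (sizes may exceed $1$). Bins have capacity $1$. Each item may be split into any finite number of parts of arbitrary positive sizes summing to the item's size. A packing assigns the parts to bins such that the total size of parts in each bin is at most $1$ and each bin contains at most $k$ parts. The objective is to minimize the number of bins; $\mathrm{OPT}(I)$ is the optimal number of bins for input $I$. NEXT FIT processes the items in the given order, maintaining one current bin: an item is placed (partially) in the current bin if that bin is not full and contains fewer than $k$ item parts; if the item does not fit entirely in the current bin, the current bin is filled with a part of the item and closed, and as many new bins are opened (and filled in order) as necessary to contain the rest of the item, the last of these becoming the current bin. If the current bin is full or already has $k$ parts, a new bin is opened. $\mathrm{NF}(I)$ is the number of bins used. *)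

theory Defs
  imports Complex_Main
begin

definition valid_input :: "real list \<Rightarrow> bool" where
  "valid_input I \<longleftrightarrow> (\<forall>s\<in>set I. 0 < s)"

text \<open>A part is a pair of the index of its item in the input and its size. A bin lists its parts.
  Several parts of one item may lie in the same bin; each then counts towards the bound \<open>k\<close>.\<close>

type_synonym part = "nat \<times> real"
type_synonym bin = "part list"

definition load :: "bin \<Rightarrow> real" where
  "load b = (\<Sum>p\<leftarrow>b. snd p)"

definition is_packing :: "nat \<Rightarrow> real list \<Rightarrow> bin list \<Rightarrow> bool" where
  "is_packing k I B \<longleftrightarrow>
     (\<forall>b\<in>set B. load b \<le> 1 \<and> length b \<le> k \<and> (\<forall>(i, s)\<in>set b. i < length I \<and> 0 < s)) \<and>
     (\<forall>i<length I. (\<Sum>p\<leftarrow>filter (\<lambda>p. fst p = i) (concat B). snd p) = I ! i)"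

definition OPT :: "nat \<Rightarrow> real list \<Rightarrow> nat" where
  "OPT k I = (LEAST m. \<exists>B. is_packing k I B \<and> length B = m)"

text \<open>The state of NEXT FIT is the list of its bins, most recently opened bin first; the head is the
  current bin. \<open>open_bins i s B\<close> packs an amount \<open>s\<close> of item \<open>i\<close> into new bins only.\<close>

function open_bins :: "nat \<Rightarrow> real \<Rightarrow> bin list \<Rightarrow> bin list" where
  "open_bins i s B = (if s \<le> 1 then [(i, s)] # B else open_bins i (s - 1) ([(i, 1)] # B))"
  by auto
termination
  by (relation "measure (\<lambda>(i, s, B). nat \<lceil>s\<rceil>)") auto

declare open_bins.simps [simp del]

fun nf_step :: "nat \<Rightarrow> part \<Rightarrow> bin list \<Rightarrow> bin list" where
  "nf_step k (i, s) [] = open_bins i s []"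
| "nf_step k (i, s) (b # B) =
     (if load b < 1 \<and> length b < k then
        if load b + s \<le> 1 then (b @ [(i, s)]) # B
        else open_bins i (s - (1 - load b)) ((b @ [(i, 1 - load b)]) # B)
      else open_bins i s (b # B))"

definition next_fit :: "nat \<Rightarrow> real list \<Rightarrow> bin list" where
  "next_fit k I = fold (nf_step k) (enumerate 0 I) []"

definition NF :: "nat \<Rightarrow> real list \<Rightarrow> nat" where
  "NF k I = length (next_fit k I)"

end

theory Submission
  imports Defs
begin

text \<open>A packing into \<open>m\<close> bins forces both \<open>\<Sum>s \<le> m\<close> and \<open>\<Sum>\<lceil>s\<rceil> \<le> k m\<close>, since an item of size \<open>s\<close> has at
  least \<open>\<lceil>s\<rceil>\<close> parts. Let \<open>f\<close> and \<open>g\<close> count the closed bins of NEXT FIT that are full, respectively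
  not full (these hold \<open>k\<close> parts). The current bin has positive load, so \<open>f < \<Sum>s\<close>, i.e.
  \<open>f \<le> m - 1\<close>; and step by step one sees \<open>f + k g + 1 \<le> \<Sum>\<lceil>s\<rceil> \<le> k m\<close>. Adding \<open>k - 1\<close> times the first
  bound to the second gives \<open>k (f + g + 1) \<le> (2 k - 1) m\<close>.

  For tightness take one item of size \<open>N - 1\<close> followed by \<open>N (k - 1)\<close> equal items of total size \<open>1\<close>:
  \<open>N\<close> bins suffice, but NEXT FIT fills \<open>N - 1\<close> bins with the large item and then packs at most \<open>k\<close>
  small items per bin.\<close>

section \<open>Bounds on packings\<close>

text \<open>Groups the parts by item. It serves two double counts: with \<open>h\<close> the size it
  gives total volume, with \<open>h\<close> constantly 1 the number of parts.\<close>

lemma sum_filter_fst: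
  fixes h :: "nat \<times> 'a \<Rightarrow> 'b::comm_monoid_add"
  assumes "\<forall>p\<in>set L. fst p < n"
  shows "(\<Sum>i<n. \<Sum>p\<leftarrow>filter (\<lambda>p. fst p = i) L. h p) = (\<Sum>p\<leftarrow>L. h p)"
  using assms
proof (induction L)
  case (Cons p L)
  have "(\<Sum>i<n. \<Sum>q\<leftarrow>filter (\<lambda>q. fst q = i) (p # L). h q) =
        (\<Sum>i<n. (if fst p = i then h p else 0) + (\<Sum>q\<leftarrow>filter (\<lambda>q. fst q = i) L. h q))"
    by (intro sum.cong) auto
  also have "\<dots> = h p + (\<Sum>q\<leftarrow>L. h q)"
    using Cons by (simp add: sum.distrib)
  finally show ?case by simp
qed simp

lemma sum_list_filter_concat:
  fixes h :: "'a \<Rightarrow> 'b::comm_monoid_add"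
  shows "(\<Sum>p\<leftarrow>filter P (concat B). h p) = (\<Sum>b\<leftarrow>B. \<Sum>p\<leftarrow>b. if P p then h p else 0)"
  by (induction B) (simp_all add: sum_list_map_filter')

lemma sum_list_concat_le:
  fixes h :: "'a \<Rightarrow> 'b::linordered_semidom"
  assumes "\<forall>b\<in>set B. (\<Sum>p\<leftarrow>b. h p) \<le> c"
  shows "(\<Sum>p\<leftarrow>concat B. h p) \<le> of_nat (length B) * c"
  using assms by (induction B) (auto simp: distrib_right add_mono)

lemma part_size_le_1:
  assumes "is_packing k I B" "p \<in> set (concat B)"
  shows "snd p \<le> 1"
proof -
  obtain b where b: "b \<in> set B" "p \<in> set b" using assms(2) by auto
  have "snd p \<le> load b"
    unfolding load_def using assms(1) b
    by (intro member_le_sum_list) (fastforce simp: is_packing_def)+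
  also have "\<dots> \<le> 1" using assms(1) b by (auto simp: is_packing_def)
  finally show ?thesis .
qed

lemma packing_size_bound:
  assumes "is_packing k I B"
  shows "sum_list I \<le> real (length B)"
proof -
  have fst: "\<forall>p\<in>set (concat B). fst p < length I"
    using assms by (fastforce simp: is_packing_def)
  have "sum_list I = (\<Sum>i<length I. I ! i)"
    by (simp add: sum_list_sum_nth atLeast0LessThan)
  also have "\<dots> = (\<Sum>i<length I. \<Sum>p\<leftarrow>filter (\<lambda>p. fst p = i) (concat B). snd p)"
    using assms by (intro sum.cong) (auto simp: is_packing_def)
  also have "\<dots> = (\<Sum>p\<leftarrow>concat B. snd p)"
    by (rule sum_filter_fst[OF fst])
  also have "\<dots> \<le> real (length B) * 1"
    using assms by (intro sum_list_concat_le) (auto simp: is_packing_def load_def)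
  finally show ?thesis by simp
qed

text \<open>Counts all parts twice: by bin there are at most \<open>k\<close> in each, and by item
  at least \<open>nat \<lceil>s\<rceil>\<close>, because no part exceeds the capacity 1 of its
  bin.\<close>

lemma packing_parts_bound:
  assumes "is_packing k I B"
  shows "(\<Sum>s\<leftarrow>I. nat \<lceil>s\<rceil>) \<le> k * length B"
proof -
  have fst: "\<forall>p\<in>set (concat B). fst p < length I"
    using assms by (fastforce simp: is_packing_def)
  have parts: "nat \<lceil>I ! i\<rceil> \<le> length (filter (\<lambda>p. fst p = i) (concat B))"
    if "i < length I" for i
  proof -
    let ?F = "filter (\<lambda>p. fst p = i) (concat B)"
    have "I ! i = (\<Sum>p\<leftarrow>?F. snd p)"
      using assms that by (auto simp: is_packing_def)
    also have "\<dots> \<le> (\<Sum>p\<leftarrow>?F. 1)"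
      using part_size_le_1[OF assms] by (intro sum_list_mono) auto
    also have "\<dots> = real (length ?F)" by (simp add: sum_list_triv)
    finally show ?thesis by linarith
  qed
  have "(\<Sum>s\<leftarrow>I. nat \<lceil>s\<rceil>) = (\<Sum>i<length I. nat \<lceil>I ! i\<rceil>)"
    by (simp add: sum_list_sum_nth atLeast0LessThan)
  also have "\<dots> \<le> (\<Sum>i<length I. \<Sum>p\<leftarrow>filter (\<lambda>p. fst p = i) (concat B). 1)"
    using parts by (intro sum_mono) (simp add: sum_list_triv)
  also have "\<dots> = (\<Sum>p\<leftarrow>concat B. 1)"
    by (rule sum_filter_fst[OF fst])
  also have "\<dots> \<le> of_nat (length B) * k"
    using assms by (intro sum_list_concat_le) (auto simp: is_packing_def sum_list_triv)
  finally show ?thesis by (simp add: mult.commute)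
qed

text \<open>Cut each item into \<open>nat \<lceil>s\<rceil>\<close> equal parts and give each part a
  bin of its own. This ensures that the \<open>LEAST\<close> in \<open>OPT\<close> is
  attained.\<close>

lemma packing_exists:
  assumes "valid_input I" "k \<ge> 1"
  shows "\<exists>B. is_packing k I B"
proof -
  define c where "c i = nat \<lceil>I ! i\<rceil>" for i
  define r where "r i = I ! i / real (c i)" for i
  define B where "B = concat (map (\<lambda>i. replicate (c i) [(i, r i)]) [0..<length I])"
  have c: "0 < c i" "0 < r i" "r i \<le> 1" "real (c i) * r i = I ! i" if "i < length I" for i
  proof -
    have pos: "0 < I ! i" using assms(1) that by (auto simp: valid_input_def)
    then show "0 < c i" by (simp add: c_def)
    then show "0 < r i" "real (c i) * r i = I ! i" using pos by (simp_all add: r_def)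
    have "I ! i \<le> real (c i)" unfolding c_def by linarith
    then show "r i \<le> 1" using \<open>0 < c i\<close> by (simp add: r_def)
  qed
  \<comment> \<open>Stated for an arbitrary index list \<open>js\<close> so that induction
    applies.\<close>
  have sum_B: "(\<Sum>b\<leftarrow>concat (map (\<lambda>i. replicate (c i) [(i, r i)]) js). \<Sum>p\<leftarrow>b. if fst p = i then snd p else 0)
      = (\<Sum>j\<leftarrow>js. if j = i then real (c j) * r j else 0)" for i js
    by (induction js) (simp_all add: sum_list_replicate)
  have "(\<Sum>p\<leftarrow>filter (\<lambda>p. fst p = i) (concat B). snd p) = I ! i" if "i < length I" for i
    unfolding sum_list_filter_concat B_def sum_B
    using that c by (simp add: interv_sum_list_conv_sum_set_nat)
  then have "is_packing k I B"
    using c assms(2) by (auto simp: is_packing_def B_def load_def)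
  then show ?thesis by blast
qed

lemma OPT_packing:
  assumes "valid_input I" "k \<ge> 1"
  obtains B where "is_packing k I B" "length B = OPT k I"
proof -
  have "\<exists>m B. is_packing k I B \<and> length B = m" using packing_exists[OF assms] by blast
  then have "\<exists>B. is_packing k I B \<and> length B = OPT k I"
    unfolding OPT_def by (rule LeastI_ex)
  then show thesis using that by blast
qed

section \<open>Upper bound for NEXT FIT\<close>

text \<open>Closed form of the recursion. The remainder \<open>r\<close> ranges over the half-open
  interval from 0 (excluded) to 1 (included): for integral \<open>s\<close> the last bin is exactly
  full and no empty bin is opened.\<close>

lemma open_bins_cases:
  assumes "0 < s"
  obtains n r where "open_bins i s B = [(i, r)] # replicate n [(i, 1)] @ B"
    "0 < r" "r \<le> 1" "s = real n + r"
proof -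
  have "\<exists>n r. open_bins i s B = [(i, r)] # replicate n [(i, 1)] @ B \<and> 0 < r \<and> r \<le> 1 \<and> s = real n + r"
    using assms
  proof (induction i s B rule: open_bins.induct)
    case (1 i s B)
    show ?case
    proof (cases "s \<le> 1")
      case True
      then show ?thesis
        using "1.prems" by (intro exI[of _ 0] exI[of _ s]) (simp add: open_bins.simps[of i s])
    next
      case False
      then obtain n r where "open_bins i (s - 1) ([(i, 1)] # B) = [(i, r)] # replicate n [(i, 1)] @ [(i, 1)] # B"
        "0 < r" "r \<le> 1" "s - 1 = real n + r"
        using "1.IH" by auto
      then show ?thesis
        using False
        by (intro exI[of _ "Suc n"] exI[of _ r])
          (simp add: open_bins.simps[of i s] replicate_app_Cons_same)
    qed
  qed
  then show thesis using that by blast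
qed

text \<open>\<open>S\<close> and \<open>C\<close> are the sums of \<open>s\<close> and of \<open>\<lceil>s\<rceil>\<close> over the items packed so far; \<open>f\<close> and \<open>g\<close> count
  the full and the non-full closed bins.\<close>

definition nf_inv :: "nat \<Rightarrow> real \<Rightarrow> nat \<Rightarrow> bin list \<Rightarrow> bool" where
  "nf_inv k S C st \<longleftrightarrow> (\<exists>b B f g. st = b # B \<and> 0 < load b \<and> load b \<le> 1 \<and> 1 \<le> length b \<and> length b \<le> k \<and>
     length B = f + g \<and> real f + load b \<le> S \<and> f + k * g + length b \<le> C)"

lemma nf_inv_first:
  assumes "0 < s" "1 \<le> k"
  shows "nf_inv k s (nat \<lceil>s\<rceil>) (nf_step k (i, s) [])"
proof -
  obtain n r where "open_bins i s [] = [(i, r)] # replicate n [(i, 1)] @ []"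
    and r: "0 < r" "r \<le> 1" "s = real n + r"
    using open_bins_cases[OF assms(1)] .
  moreover have "nat \<lceil>s\<rceil> = n + 1" using r by linarith
  ultimately show ?thesis
    using assms(2) unfolding nf_inv_def
    by (intro exI[of _ "[(i, r)]"] exI[of _ "replicate n [(i, 1)]"] exI[of _ n] exI[of _ 0])
      (simp add: load_def)
qed

text \<open>When a bin closes, its parts pay for it in the bound on \<open>C\<close>: a full bin
  needs one of its at least one parts, a non-full bin needs all its \<open>k\<close> parts. A full
  bin with \<open>k\<close> parts is counted in \<open>f\<close>.\<close>

lemma nf_inv_step:
  assumes "nf_inv k S C st" "0 < s" "1 \<le> k"
  shows "nf_inv k (S + s) (C + nat \<lceil>s\<rceil>) (nf_step k (i, s) st)"
proof -
  obtain b B f g where st: "st = b # B" and b: "0 < load b" "load b \<le> 1" "1 \<le> length b" "length b \<le> k"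
    and B: "length B = f + g" and S: "real f + load b \<le> S" and C: "f + k * g + length b \<le> C"
    using assms(1) unfolding nf_inv_def by blast
  consider (fits) "load b < 1" "length b < k" "load b + s \<le> 1"
    | (split) "load b < 1" "length b < k" "load b + s > 1"
    | (full) "load b = 1" | (many) "length b = k" "load b < 1"
    using b by linarith
  then show ?thesis
  proof cases
    case fits
    have "1 \<le> nat \<lceil>s\<rceil>" using assms(2) by linarith
    then show ?thesis
      using fits b B S C assms(2) unfolding nf_inv_def st
      by (intro exI[of _ "b @ [(i, s)]"] exI[of _ B] exI[of _ f] exI[of _ g]) (simp add: load_def)
  next
    case split
    define b' where "b' = b @ [(i, 1 - load b)]"
    have "0 < s - (1 - load b)" using split by simp
    then obtain n r where o: "open_bins i (s - (1 - load b)) (b' # B) = [(i, r)] # replicate n [(i, 1)] @ b' # B"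
      and r: "0 < r" "r \<le> 1" "s - (1 - load b) = real n + r"
      using open_bins_cases by blast
    have step: "nf_step k (i, s) st = [(i, r)] # replicate n [(i, 1)] @ b' # B"
      using split o by (simp add: st b'_def)
    \<comment> \<open>Only an inequality: \<open>r + (1 - load b)\<close> may exceed 1, and then
      \<open>nat \<lceil>s\<rceil>\<close> is \<open>n + 2\<close>.\<close>
    have "n + 1 \<le> nat \<lceil>s\<rceil>" using r split by linarith
    then show ?thesis
      using r b B S C assms(3) unfolding nf_inv_def step
      by (intro exI[of _ "[(i, r)]"] exI[of _ "replicate n [(i, 1)] @ b' # B"] exI[of _ "f + n + 1"] exI[of _ g])
        (simp add: load_def)
  next
    case full
    obtain n r where o: "open_bins i s (b # B) = [(i, r)] # replicate n [(i, 1)] @ b # B"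
      and r: "0 < r" "r \<le> 1" "s = real n + r"
      using open_bins_cases[OF assms(2)] .
    have step: "nf_step k (i, s) st = [(i, r)] # replicate n [(i, 1)] @ b # B"
      using full o by (simp add: st)
    have "nat \<lceil>s\<rceil> = n + 1" using r by linarith
    then show ?thesis
      using r b B S C full assms(3) unfolding nf_inv_def step
      by (intro exI[of _ "[(i, r)]"] exI[of _ "replicate n [(i, 1)] @ b # B"] exI[of _ "f + n + 1"] exI[of _ g])
        (simp add: load_def)
  next
    case many
    obtain n r where o: "open_bins i s (b # B) = [(i, r)] # replicate n [(i, 1)] @ b # B"
      and r: "0 < r" "r \<le> 1" "s = real n + r"
      using open_bins_cases[OF assms(2)] .
    have step: "nf_step k (i, s) st = [(i, r)] # replicate n [(i, 1)] @ b # B"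
      using many o by (simp add: st)
    have "nat \<lceil>s\<rceil> = n + 1" using r by linarith
    then show ?thesis
      using r b B S C many assms(3) unfolding nf_inv_def step
      by (intro exI[of _ "[(i, r)]"] exI[of _ "replicate n [(i, 1)] @ b # B"] exI[of _ "f + n"] exI[of _ "g + 1"])
        (simp add: load_def)
  qed
qed

lemma nf_inv_fold:
  assumes "nf_inv k S C st" "\<forall>s\<in>set I. 0 < s" "1 \<le> k"
  shows "nf_inv k (S + sum_list I) (C + (\<Sum>s\<leftarrow>I. nat \<lceil>s\<rceil>)) (fold (nf_step k) (enumerate a I) st)"
  using assms(1,2)
proof (induction I arbitrary: S C st a)
  case (Cons s I)
  have "nf_inv k (S + s) (C + nat \<lceil>s\<rceil>) (nf_step k (a, s) st)"
    using Cons.prems assms(3) by (intro nf_inv_step) auto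
  from Cons.IH[OF this] Cons.prems show ?case by (simp add: add.assoc)
qed simp

lemma nf_inv_next_fit:
  assumes "valid_input I" "I \<noteq> []" "1 \<le> k"
  shows "nf_inv k (sum_list I) (\<Sum>s\<leftarrow>I. nat \<lceil>s\<rceil>) (next_fit k I)"
proof -
  obtain s J where I: "I = s # J" using assms(2) by (cases I) auto
  then have pos: "0 < s" "\<forall>s\<in>set J. 0 < s" using assms(1) by (auto simp: valid_input_def)
  from nf_inv_fold[OF nf_inv_first[OF pos(1) assms(3)] pos(2) assms(3)]
  show ?thesis by (simp add: next_fit_def I)
qed

theorem NF_upper_bound:
  assumes "valid_input I" "1 \<le> k"
  shows "k * NF k I \<le> (2 * k - 1) * OPT k I"
\<comment> \<open>\<open>nf_inv\<close> presupposes a current bin, so the empty input is treated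
  apart.\<close>
proof (cases "I = []")
  case True
  then show ?thesis by (simp add: NF_def next_fit_def)
next
  case False
  obtain P where P: "is_packing k I P" "length P = OPT k I"
    using OPT_packing[OF assms] .
  obtain b B f g where st: "next_fit k I = b # B" and b: "0 < load b" "1 \<le> length b"
    and B: "length B = f + g" and S: "real f + load b \<le> sum_list I"
    and C: "f + k * g + length b \<le> (\<Sum>s\<leftarrow>I. nat \<lceil>s\<rceil>)"
    using nf_inv_next_fit[OF assms(1) False assms(2)] unfolding nf_inv_def by blast
  have "f < OPT k I"
    using packing_size_bound[OF P(1)] S b P(2) by linarith
  then have "(k - 1) * (f + 1) \<le> (k - 1) * OPT k I" by (intro mult_left_mono) auto
  moreover have "f + k * g + 1 \<le> k * OPT k I"
    using packing_parts_bound[OF P(1)] C b P(2) by simp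
  moreover have "NF k I = f + g + 1" by (simp add: NF_def st B)
  \<comment> \<open>Removes the truncated subtractions \<open>k - 1\<close> and
    \<open>2 * k - 1\<close>.\<close>
  moreover obtain k' where "k = Suc k'" using assms(2) by (cases k) auto
  ultimately show ?thesis by (simp add: algebra_simps)
qed

section \<open>Tightness\<close>

text \<open>Potential: slots used in the current bin, plus all \<open>k\<close> slots of every
  closed bin, whether occupied or lost. Closing a bin never lowers it, and each item puts at least
  one part into a fresh slot.\<close>

lemma nf_step_slots:
  assumes "0 < s" "1 \<le> k" "length b \<le> k"
  obtains b' B' where "nf_step k (i, s) (b # B) = b' # B'" "length b' \<le> k"
    "k * length B + length b + 1 \<le> k * length B' + length b'"
proof -
  consider (fits) "load b < 1" "length b < k" "load b + s \<le> 1"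
    | (split) "load b < 1" "length b < k" "load b + s > 1"
    | (closed) "\<not> (load b < 1 \<and> length b < k)"
    by linarith
  then show thesis
  proof cases
    case fits
    then show thesis using that[of "b @ [(i, s)]" B] by simp
  next
    case split
    define b' where "b' = b @ [(i, 1 - load b)]"
    have "0 < s - (1 - load b)" using split by simp
    then obtain n r where "open_bins i (s - (1 - load b)) (b' # B) = [(i, r)] # replicate n [(i, 1)] @ b' # B"
      using open_bins_cases by blast
    then show thesis
      using split that[of "[(i, r)]" "replicate n [(i, 1)] @ b' # B"] assms
      by (simp add: b'_def distrib_left)
  next
    case closed
    obtain n r where "open_bins i s (b # B) = [(i, r)] # replicate n [(i, 1)] @ b # B"
      using open_bins_cases[OF assms(1)] by blast
    then have "nf_step k (i, s) (b # B) = [(i, r)] # replicate n [(i, 1)] @ b # B"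
      using closed by auto
    then show thesis
      by (rule that) (use assms in \<open>simp_all add: distrib_left\<close>)
  qed
qed

lemma nf_fold_slots:
  assumes "\<forall>s\<in>set I. 0 < s" "1 \<le> k" "length b \<le> k"
  shows "k * length B + length b + length I \<le> k * length (fold (nf_step k) (enumerate a I) (b # B))"
  using assms
proof (induction I arbitrary: a b B)
  case Nil
  then show ?case by simp
next
  case (Cons s I)
  obtain b' B' where "nf_step k (a, s) (b # B) = b' # B'" "length b' \<le> k"
    "k * length B + length b + 1 \<le> k * length B' + length b'"
    using nf_step_slots[of s k b a B] Cons.prems by auto
  then show ?case using Cons.IH[of b' B' "Suc a"] Cons.prems by simp
qed

definition tight_input :: "nat \<Rightarrow> nat \<Rightarrow> real list" where
  "tight_input k N = (real N - 1) # replicate (N * (k - 1)) (1 / real (N * (k - 1)))"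

lemma tight_input_valid: "k \<ge> 2 \<Longrightarrow> N \<ge> 2 \<Longrightarrow> valid_input (tight_input k N)"
  by (auto simp: valid_input_def tight_input_def)

text \<open>Each of the \<open>N\<close> bins takes an \<open>N\<close>-th of the large item and its
  own block of \<open>k - 1\<close> small items: \<open>k\<close> parts of total size
  \<open>(N - 1) / N + 1 / N = 1\<close>.\<close>

lemma OPT_tight_input:
  assumes "k \<ge> 2" "N \<ge> 2"
  shows "OPT k (tight_input k N) \<le> N"
proof -
  define d where "d = 1 / real (N * (k - 1))"
  define bin where "bin j = (0, (real N - 1) / real N) # map (\<lambda>x. (Suc x, d)) [j * (k - 1)..<j * (k - 1) + (k - 1)]"
    for j
  define B where "B = map bin [0..<N]"
  have d: "0 < d" "real (k - 1) * d = 1 / real N" using assms by (simp_all add: d_def)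
  have load: "load (bin j) = 1" for j
    using assms d by (simp add: load_def bin_def o_def sum_list_triv field_simps)
  have block: "j * (k - 1) + (k - 1) \<le> N * (k - 1)" if "j < N" for j
    using mult_le_mono1[of "Suc j" N "k - 1"] that by simp
  have parts: "(\<Sum>p\<leftarrow>filter (\<lambda>p. fst p = i) (concat B). snd p) = tight_input k N ! i"
    if "i < length (tight_input k N)" for i
  proof (cases i)
    case 0
    then show ?thesis
      using assms unfolding sum_list_filter_concat
      by (simp add: B_def bin_def o_def tight_input_def sum_list_triv)
  next
    case (Suc x)
    have "(\<Sum>p\<leftarrow>filter (\<lambda>p. fst p = i) (concat B). snd p)
      = (\<Sum>j<N. \<Sum>y\<in>{j * (k - 1)..<j * (k - 1) + (k - 1)}. if y = x then d else 0)"
      unfolding sum_list_filter_concat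
      by (simp add: B_def bin_def o_def Suc interv_sum_list_conv_sum_set_nat atLeast0LessThan if_distrib
          cong: if_cong)
    \<comment> \<open>The blocks of length \<open>k - 1\<close> tile the range of small items, so
      \<open>x\<close> is hit exactly once.\<close>
    also have "\<dots> = (\<Sum>y<N * (k - 1). if y = x then d else 0)"
      by (rule sum.nat_group)
    also have "\<dots> = tight_input k N ! i"
      using that by (simp add: tight_input_def Suc d_def)
    finally show ?thesis .
  qed
  have "is_packing k (tight_input k N) B"
    unfolding is_packing_def
  proof (intro conjI ballI allI impI parts)
    fix b assume "b \<in> set B"
    then obtain j where j: "j < N" "b = bin j" by (auto simp: B_def)
    show "load b \<le> 1" by (simp add: j load)
    show "length b \<le> k" using assms by (simp add: j bin_def)
    fix p assume "p \<in> set b"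
    then show "case p of (i, s) \<Rightarrow> i < length (tight_input k N) \<and> 0 < s"
      using assms d block[OF j(1)] by (auto simp: j(2) bin_def tight_input_def)
  qed
  moreover have "length B = N" by (simp add: B_def)
  ultimately show ?thesis unfolding OPT_def by (intro Least_le) blast
qed

text \<open>The large item fills \<open>N - 1\<close> bins and thus costs all their
  \<open>k * (N - 1)\<close> slots, although it is only one item; each small item then costs at
  least one further slot.\<close>

lemma NF_tight_input:
  assumes "k \<ge> 2" "N \<ge> 2"
  shows "k * (N - 1) + N * (k - 1) \<le> k * NF k (tight_input k N)"
proof -
  define d where "d = 1 / real (N * (k - 1))"
  obtain m where m: "N * (k - 1) = Suc m" using assms by (cases "N * (k - 1)") auto
  have d: "0 < d" "d \<le> 1" unfolding d_def m by simp_all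
  obtain n r where o: "open_bins 0 (real N - 1) [] = [(0, r)] # replicate n [(0, 1)] @ []"
    and r: "0 < r" "r \<le> 1" "real N - 1 = real n + r"
    by (rule open_bins_cases[of "real N - 1" 0 "[]"]) (use assms(2) in auto)
  have "N - 1 = n + 1" using r by linarith
  \<comment> \<open>As \<open>N - 1\<close> is integral, the large item ends with a full bin. Hence
    the first small item opens a new bin, from which the slot count over the other \<open>m\<close>
    items starts.\<close>
  moreover from this have "r = 1" using r assms by (simp add: of_nat_diff)
  ultimately have full: "N = Suc (Suc n)" "r = 1" using assms by auto
  have tight: "tight_input k N = (real N - 1) # d # replicate m d"
    unfolding tight_input_def d_def[symmetric] unfolding m by simp
  have "next_fit k (tight_input k N) =
    fold (nf_step k) (enumerate 2 (replicate m d)) ([(1, d)] # [(0, 1)] # replicate n [(0, 1)])"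
    using o d full(2) unfolding tight by (simp add: next_fit_def load_def open_bins.simps[of _ d] numeral_2_eq_2)
  moreover have "k * Suc n + 1 + m
     \<le> k * length (fold (nf_step k) (enumerate 2 (replicate m d)) ([(1, d)] # [(0, 1)] # replicate n [(0, 1)]))"
    using nf_fold_slots[of "replicate m d" k "[(1, d)]" "[(0, 1)] # replicate n [(0, 1)]" 2] assms(1) d
    by auto
  ultimately show ?thesis using m by (simp add: NF_def full)
qed

theorem NF_lower_bound:
  fixes \<epsilon> :: real
  assumes "k \<ge> 2" "\<epsilon> > 0"
  shows "\<exists>I. valid_input I \<and> real (NF k I) > (2 - 1 / real k - \<epsilon>) * real (OPT k I)"
proof -
  obtain N0 :: nat where "1 / \<epsilon> < real N0" using reals_Archimedean2 by blast
  \<comment> \<open>Beyond \<open>1 / \<epsilon>\<close>, the additive loss of 1 in the bound on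
    \<open>NF\<close> is less than \<open>\<epsilon> * N\<close>; adding 2 secures
    \<open>N \<ge> 2\<close>.\<close>
  define N where "N = N0 + 2"
  have N: "N \<ge> 2" "1 < \<epsilon> * real N"
    using \<open>1 / \<epsilon> < real N0\<close> assms(2) by (simp_all add: N_def field_simps)
  let ?I = "tight_input k N"
  let ?q = "2 - 1 / real k - \<epsilon>"
  have "real (k * (N - 1) + N * (k - 1)) \<le> real (k * NF k ?I)"
    using NF_tight_input[OF assms(1) N(1)] by (rule of_nat_mono)
  then have "real k * (real N - 1) + real N * (real k - 1) \<le> real k * real (NF k ?I)"
    using assms(1) N(1) by (simp add: of_nat_diff)
  then have NF: "(2 - 1 / real k) * real N - 1 \<le> real (NF k ?I)"
    using assms(1) by (simp add: field_simps)
  have "?q * real (OPT k ?I) < real (NF k ?I)"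
  \<comment> \<open>\<open>OPT\<close> is only bounded above by \<open>N\<close>, which helps for a
    nonnegative factor; for a negative one, \<open>NF > 0\<close> suffices.\<close>
  proof (cases "?q \<ge> 0")
    case True
    then have "?q * real (OPT k ?I) \<le> ?q * real N"
      using OPT_tight_input[OF assms(1) N(1)] by (intro mult_left_mono) auto
    also have "\<dots> < (2 - 1 / real k) * real N - 1"
      using N(2) by (simp add: algebra_simps)
    finally show ?thesis using NF by simp
  next
    case False
    have "1 / real k \<le> 1" using assms(1) by simp
    then have "1 * 2 \<le> (2 - 1 / real k) * real N"
      using N(1) by (intro mult_mono) auto
    then have "0 < real (NF k ?I)" using NF by linarith
    moreover have "?q * real (OPT k ?I) \<le> 0"
      using False by (intro mult_nonpos_nonneg) auto
    ultimately show ?thesis by linarith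
  qed
  then show ?thesis using tight_input_valid[OF assms(1) N(1)] by blast
qed

theorem theorem2:
  fixes k :: nat
  assumes "k \<ge> 2"
  shows "(\<forall>I. valid_input I \<longrightarrow> real (NF k I) \<le> (2 - 1 / real k) * real (OPT k I)) \<and>
         (\<forall>\<epsilon>::real. \<epsilon> > 0 \<longrightarrow>
            (\<exists>I. valid_input I \<and> real (NF k I) > (2 - 1 / real k - \<epsilon>) * real (OPT k I)))"
proof (intro conjI allI impI)
  fix I assume I: "valid_input I"
  have "real (k * NF k I) \<le> real ((2 * k - 1) * OPT k I)"
    using NF_upper_bound[OF I] assms by (intro of_nat_mono) simp
  then have "real k * real (NF k I) \<le> (2 * real k - 1) * real (OPT k I)"
    using assms by (simp add: of_nat_diff)
  then show "real (NF k I) \<le> (2 - 1 / real k) * real (OPT k I)"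
    using assms by (simp add: field_simps)
next
  fix \<epsilon> :: real assume "\<epsilon> > 0"
  then show "\<exists>I. valid_input I \<and> real (NF k I) > (2 - 1 / real k - \<epsilon>) * real (OPT k I)"
    using NF_lower_bound assms by blast
qed

end
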